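(* Let $r, d_\ell^{\mathrm{in}}, d_\ell^{\mathrm{out}}$ be positive integers, let $A_\ell\in\mathbb{R}^{r\times d_\ell^{\mathrm{in}}}$, $B_\ell\in\mathbb{R}^{d_\ell^{\mathrm{out}}\times r}$, $h_{\ell,t}\in\mathbb{R}^{d_\ell^{\mathrm{in}}}$, and $\alpha(t)\in\mathbb{R}$. Define $$\delta_{\ell,t}=\frac{\alpha(t)}{r}B_\ell A_\ell h_{\ell,t}.$$ If $a_\ell,b_\ell,H_{\ell,t}$ are finite real constants with $\|A_\ell\|_2\leq a_\ell$, $\|B_\ell\|_2\leq b_\ell$, and $\|h_{\ell,t}\|_2\leq H_{\ell,t}$, then $$\|\delta_{\ell,t}\|_2\leq \frac{|\alpha(t)|}{r}\,b_\ell\, a_\ell\, H_{\ell,t}.$$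
   Context: For vectors, $\|\cdot\|_2$ is the Euclidean norm; for matrices, $\|\cdot\|_2$ is the spectral norm (the operator norm induced by the Euclidean norms). The indices $\ell$ (layer) and $t$ (timestep) are fixed labels. *)

theory Defs
  imports "HOL-Analysis.Analysis"
begin

text \<open>
  Positive dimensions are index types of class \<open>finite\<close>; a matrix with \<open>m\<close> rows and \<open>n\<close>
  columns has type \<open>real ^ 'n ^ 'm\<close>. The class instance \<open>norm\<close> on that type is the Frobenius
  norm, so the spectral norm is introduced separately, as the operator norm of the associated
  linear map with respect to the Euclidean norms.
\<close>

definition spectral_norm :: "real ^ 'n ^ 'm \<Rightarrow> real" where
  "spectral_norm M = onorm (\<lambda>x. M *v x)"

definition lora_delta ::
    "real \<Rightarrow> real ^ 'r ^ 'dout \<Rightarrow> real ^ 'din ^ 'r \<Rightarrow> real ^ 'din \<Rightarrow> real ^ 'dout" where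
  "lora_delta c B A h = (c / real CARD('r)) *\<^sub>R ((B ** A) *v h)"

end

theory Submission
  imports Defs
begin

text \<open>The spectral norm is an operator norm, so applying a matrix stretches a vector by at
  most that factor (\<open>norm_matrix_vector_mult_le\<close>). Using this for \<open>B\<close> and
  then for \<open>A\<close> bounds the image of \<open>h t\<close> by b a H; the scalar factor comes
  out of the norm as its absolute value.\<close>

text \<open>Bounded linearity makes the real supremum behind \<open>onorm\<close> a genuine upper
  bound for the quotients \<open>norm (M *v x) / norm x\<close>.\<close>

lemma norm_matrix_vector_mult_le: "norm (M *v x) \<le> spectral_norm M * norm x"
  unfolding spectral_norm_def by (rule onorm[OF matrix_vector_mul_bounded_linear])

lemma spectral_norm_nonneg: "0 \<le> spectral_norm M"
  unfolding spectral_norm_def by (rule onorm_pos_le[OF matrix_vector_mul_bounded_linear])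

theorem lemma4p2:
  fixes A :: "real ^ 'din ^ 'r"
    and B :: "real ^ 'r ^ 'dout"
    and h :: "'t \<Rightarrow> real ^ 'din"
    and \<alpha> :: "'t \<Rightarrow> real"
    and a b :: real
    and H :: "'t \<Rightarrow> real"
    and t :: 't
  assumes "spectral_norm A \<le> a"
    and "spectral_norm B \<le> b"
    and "norm (h t) \<le> H t"
  shows "norm (lora_delta (\<alpha> t) B A (h t)) \<le> \<bar>\<alpha> t\<bar> / real CARD('r) * b * a * H t"
proof -
  \<comment> \<open>The signs of \<open>a\<close> and \<open>b\<close> are inherited from the norms
    they dominate; the monotonicity of products below relies on them.\<close>
  have a: "0 \<le> a" and b: "0 \<le> b"
    using assms(1,2) spectral_norm_nonneg order_trans by blast+
  have "norm ((B ** A) *v h t) = norm (B *v (A *v h t))"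
    by (simp add: matrix_vector_mul_assoc)
  also have "\<dots> \<le> spectral_norm B * norm (A *v h t)"
    by (rule norm_matrix_vector_mult_le)
  also have "\<dots> \<le> b * norm (A *v h t)"
    using assms(2) by (rule mult_right_mono) simp
  also have "\<dots> \<le> b * (spectral_norm A * norm (h t))"
    using norm_matrix_vector_mult_le b by (rule mult_left_mono)
  \<comment> \<open>Both inner factors grow at once: \<open>mult_mono\<close> asks only for 0 \<le>
    \<open>a\<close> and 0 \<le> \<open>norm (h t)\<close>.\<close>
  also have "\<dots> \<le> b * (a * H t)"
    using assms(1,3) a b by (intro mult_left_mono mult_mono) auto
  finally have "\<bar>\<alpha> t\<bar> / real CARD('r) * norm ((B ** A) *v h t)
      \<le> \<bar>\<alpha> t\<bar> / real CARD('r) * (b * (a * H t))"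
    by (rule mult_left_mono) simp
  then show ?thesis
    by (simp add: lora_delta_def mult.assoc)
qed

end
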